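(* Let $k\in\{0,1,2,\dots\}\cup\{\infty\}$ and let $\varphi\in\mathrm{Diff}(\mathbb{S}^1)$ be a fixed point free diffeomorphism of the circle. If $\varphi$ preserves a $C^k$ volume form on $\mathcal{C}=\mathbb{S}^1\times\mathbb{S}^1\setminus\Delta$, then $\varphi$ is $C^{k+1}$ conjugate to a rotation, i.e. there is a $C^{k+1}$ diffeomorphism $h$ of $\mathbb{S}^1$ such that $h^{-1}\varphi h$ is a rotation (with $\infty+1=\infty$).
   Context: $\Delta$ is the diagonal of $\mathbb{S}^1\times\mathbb{S}^1$. $\mathrm{Diff}(\mathbb{S}^1)$ is the group of $C^\infty$ diffeomorphisms of $\mathbb{S}^1$. A ($C^k$) volume form on $\mathcal{C}$ is $\omega(x,y)\,dx\wedge dy$ with $\omega>0$ of class $C^k$; $\varphi$ preserves it if $\omega(\varphi(x),\varphi(y))\varphi'(x)\varphi'(y)=\omega(x,y)$ for all $x\neq y$. *)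

theory Defs
  imports "HOL-Analysis.Analysis" "HOL-Library.Extended_Nat"
begin

primrec higher_differentiable_on ::
    "nat \<Rightarrow> 'a::euclidean_space set \<Rightarrow> ('a \<Rightarrow> 'b::real_normed_vector) \<Rightarrow> bool" where
  "higher_differentiable_on 0 S f \<longleftrightarrow> continuous_on S f"
| "higher_differentiable_on (Suc n) S f \<longleftrightarrow>
     (\<forall>x\<in>S. f differentiable (at x)) \<and>
     (\<forall>v. higher_differentiable_on n S (\<lambda>x. frechet_derivative f (at x) v))"

text \<open>Class \<open>C\<^sup>k\<close> on \<open>S\<close>, including \<open>k = \<infinity>\<close>; only meant for open \<open>S\<close>.\<close>

definition Ck_on :: "enat \<Rightarrow> 'a::euclidean_space set \<Rightarrow> ('a \<Rightarrow> 'b::real_normed_vector) \<Rightarrow> bool" where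
  "Ck_on k S f \<longleftrightarrow> (\<forall>n. enat n \<le> k \<longrightarrow> higher_differentiable_on n S f)"

text \<open>
  The circle is the unit circle of the complex plane, with smooth structure and coordinate
  differential \<open>dx\<close> given by the angle, that is by the local diffeomorphism
  \<^const>\<open>cis\<close> from the line onto it. Functions on the circle are functions on
  \<^typ>\<open>complex\<close> whose values off the circle are irrelevant.
\<close>

abbreviation circle :: "complex set" where
  "circle \<equiv> sphere 0 1"

definition circle_diffeo :: "enat \<Rightarrow> (complex \<Rightarrow> complex) \<Rightarrow> bool" where
  "circle_diffeo k f \<longleftrightarrow> bij_betw f circle circle \<and>
     Ck_on k UNIV (\<lambda>t. f (cis t)) \<and> Ck_on k UNIV (\<lambda>t. inv_into circle f (cis t))"

text \<open>
  The derivative of a circle map with respect to the angle: if \<open>F\<close> is a lift of \<open>f\<close>, so that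
  \<open>f (cis t) = cis (F t)\<close>, then the derivative of \<open>f (cis t)\<close> in \<open>t\<close> is
  \<open>F' t * \<i> * f (cis t)\<close>, and \<open>f' (cis t)\<close> means \<open>F' t\<close>; see \<open>circle_deriv_lift\<close>.
\<close>

definition circle_deriv :: "(complex \<Rightarrow> complex) \<Rightarrow> complex \<Rightarrow> real" where
  "circle_deriv f x = Re (vector_derivative (\<lambda>t. f (cis t)) (at (Arg x)) / (\<i> * f x))"

lemma circle_deriv_lift:
  fixes F :: "real \<Rightarrow> real"
  assumes lift: "\<And>s. f (cis s) = cis (F s)" and F: "(F has_real_derivative D) (at t)"
  shows "circle_deriv f (cis t) = D"
proof -
  have "cis (Arg (cis t)) = cis t"
    by (simp add: cis_Arg sgn_div_norm)
  then obtain n :: int where n: "t = Arg (cis t) + 2 * pi * n"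
    by (metis cis_conv_exp exp_eq complex_i_not_zero mult_cancel_left of_real_eq_iff sin_cos_eq_iff
        cis.sel)
  define a where "a = Arg (cis t)"
  have shift: "f (cis s) = cis (F (s + 2 * pi * n))" for s
    using lift[of "s + 2 * pi * n"] by (simp flip: cis_mult)
  have "((\<lambda>s. F (s + 2 * pi * n)) has_real_derivative D) (at a)"
    using F n DERIV_shift[of F D a "2 * pi * n"] by (simp add: a_def)
  then have "((\<lambda>s. cis (F (s + 2 * pi * n))) has_vector_derivative
      D *\<^sub>R (\<i> * cis (F (a + 2 * pi * n)))) (at a)"
    by (auto intro!: derivative_eq_intros
        simp: has_vector_derivative_def has_field_derivative_def mult.commute)
  then have "vector_derivative (\<lambda>s. f (cis s)) (at a) = D *\<^sub>R (\<i> * f (cis t))"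
    using shift lift n by (simp add: vector_derivative_at a_def)
  then show ?thesis
    using lift by (simp add: circle_deriv_def a_def scaleR_conv_of_real)
qed

definition config_space :: "(complex \<times> complex) set" where
  "config_space = circle \<times> circle - {(x, y). x = y}"

text \<open>The volume form \<open>\<omega>(x,y) dx \<and> dy\<close> is represented by its density \<open>\<omega>\<close>.\<close>

definition volume_form :: "enat \<Rightarrow> (complex \<times> complex \<Rightarrow> real) \<Rightarrow> bool" where
  "volume_form k \<omega> \<longleftrightarrow> (\<forall>p\<in>config_space. \<omega> p > 0) \<and>
     Ck_on k {(s::real, t::real). (cis s, cis t) \<in> config_space} (\<lambda>(s, t). \<omega> (cis s, cis t))"

definition preserves_form :: "(complex \<Rightarrow> complex) \<Rightarrow> (complex \<times> complex \<Rightarrow> real) \<Rightarrow> bool" where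
  "preserves_form \<phi> \<omega> \<longleftrightarrow> (\<forall>(x, y)\<in>config_space.
     \<omega> (\<phi> x, \<phi> y) * circle_deriv \<phi> x * circle_deriv \<phi> y = \<omega> (x, y))"

definition is_rotation :: "(complex \<Rightarrow> complex) \<Rightarrow> bool" where
  "is_rotation r \<longleftrightarrow> (\<exists>\<theta>. \<forall>x\<in>circle. r x = cis \<theta> * x)"

end

theory Submission
  imports Defs
begin

text \<open>
  A fixed point free circle diffeomorphism \<open>\<phi>\<close> preserves the orientation, so \<open>\<phi>' > 0\<close>, and its graph
  lies in the configuration space, where it is invariant under \<open>\<phi> \<times> \<phi>\<close>. Evaluating the preserved
  form along the graph gives a positive function \<open>p x = \<omega> (x, \<phi> x)\<close> of class \<open>C\<^sup>k\<close> with
  \<open>p (\<phi> x) * \<phi>' x * \<phi>' (\<phi> x) = p x\<close>. Multiplying by \<open>\<phi>' x\<close> and taking roots shows that the density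
  \<open>m x = sqrt (p x * \<phi>' x)\<close> satisfies \<open>m (\<phi> x) * \<phi>' x = m x\<close>, that is, \<open>m x dx\<close> is a positive
  \<open>\<phi>\<close>-invariant one-form on the circle, again of class \<open>C\<^sup>k\<close>.

  Integrating \<open>m\<close>, normalised to total length \<open>2 * pi\<close>, gives a coordinate on the circle of class
  \<open>C\<^bsup>k+1\<^esup>\<close> in which \<open>\<phi>\<close> has derivative one, hence is a rotation
  (\<open>conjugate_to_rotation_of_invariant_density\<close>). The analysis is carried out on the line: the
  angular lift of \<open>\<phi>\<close> and the sign of its derivative come from \<open>fixed_point_free_lift\<close>, and the
  orders of regularity are tracked by closure of \<open>C\<^sup>n\<close> under composition and inversion
  (\<open>higher_differentiable_on_compose\<close>, \<open>higher_differentiable_on_inverse_function\<close>).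
\<close>

section \<open>Calculus of functions of class \<open>C\<^sup>n\<close>\<close>

lemma higher_differentiable_on_has_derivative:
  assumes "higher_differentiable_on (Suc n) S f" and "x \<in> S"
  shows "(f has_derivative frechet_derivative f (at x)) (at x)"
  using assms frechet_derivative_works by auto

lemma higher_differentiable_on_cong:
  assumes "open S" and "\<And>x. x \<in> S \<Longrightarrow> f x = g x" and "higher_differentiable_on n S f"
  shows "higher_differentiable_on n S g"
  using assms(2,3)
proof (induction n arbitrary: f g)
  case 0
  then show ?case
    using continuous_on_cong[of S S f g] by auto
next
  case (Suc n)
  have der: "(g has_derivative frechet_derivative f (at x)) (at x)" if "x \<in> S" for x
    using has_derivative_transform_within_open[OF
        higher_differentiable_on_has_derivative[OF Suc.prems(2) that] \<open>open S\<close> that] Suc.prems(1)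
    by auto
  have eq: "frechet_derivative f (at x) v = frechet_derivative g (at x) v" if "x \<in> S" for x v
    using frechet_derivative_at[OF der[OF that]] by simp
  have "higher_differentiable_on n S (\<lambda>x. frechet_derivative g (at x) v)" for v
    by (rule Suc.IH[of "\<lambda>x. frechet_derivative f (at x) v"]) (use eq Suc.prems(2) in auto)
  then show ?case
    using der by (auto simp: differentiable_def)
qed

lemma higher_differentiable_on_SucI:
  assumes "open S" and "\<And>x. x \<in> S \<Longrightarrow> (f has_derivative D x) (at x)"
    and "\<And>v. higher_differentiable_on n S (\<lambda>x. D x v)"
  shows "higher_differentiable_on (Suc n) S f"
proof -
  have "higher_differentiable_on n S (\<lambda>x. frechet_derivative f (at x) v)" for v
    by (rule higher_differentiable_on_cong[OF assms(1) _ assms(3)[of v]])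
      (simp add: frechet_derivative_at[OF assms(2), symmetric])
  then show ?thesis
    using assms(2) by (auto simp: differentiable_def)
qed

text \<open>
  On the line all directional derivatives are multiples of the one in direction \<open>1\<close>, which reduces
  the class \<open>C\<^bsup>n+1\<^esup>\<close> to the class \<open>C\<^sup>n\<close> of a single function.
\<close>

lemma higher_differentiable_on_Suc_real:
  fixes f :: "real \<Rightarrow> 'b::real_normed_vector"
  assumes "open S" and "\<And>x. x \<in> S \<Longrightarrow> (f has_vector_derivative f' x) (at x)"
  shows "higher_differentiable_on (Suc n) S f \<longleftrightarrow> higher_differentiable_on n S f'"
    (is "?L \<longleftrightarrow> ?R")
proof -
  have scale: "higher_differentiable_on n S (\<lambda>x. v *\<^sub>R g x)"
    if "higher_differentiable_on n S g" for v n and g :: "real \<Rightarrow> 'b"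
    using that
  proof (induction n arbitrary: g)
    case 0
    then show ?case
      by (auto intro!: continuous_intros)
  next
    case (Suc n)
    show ?case
    proof (rule higher_differentiable_on_SucI[OF \<open>open S\<close>])
      show "((\<lambda>x. v *\<^sub>R g x) has_derivative (\<lambda>u. v *\<^sub>R frechet_derivative g (at x) u)) (at x)"
        if "x \<in> S" for x
        by (intro derivative_intros higher_differentiable_on_has_derivative[OF Suc.prems that])
      show "higher_differentiable_on n S (\<lambda>x. v *\<^sub>R frechet_derivative g (at x) u)" for u
        using Suc by simp
    qed
  qed
  have fr: "frechet_derivative f (at x) v = v *\<^sub>R f' x" if "x \<in> S" for x v
    using frechet_derivative_at[OF assms(2)[OF that, unfolded has_vector_derivative_def]]
    by (simp add: fun_eq_iff)
  show ?thesis
  proof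
    assume ?L
    then have "higher_differentiable_on n S (\<lambda>x. frechet_derivative f (at x) 1)"
      by simp
    then show ?R
      by (rule higher_differentiable_on_cong[OF \<open>open S\<close>, rotated]) (simp add: fr)
  next
    assume ?R
    show ?L
      by (rule higher_differentiable_on_SucI[OF \<open>open S\<close>
            assms(2)[unfolded has_vector_derivative_def] scale[OF \<open>?R\<close>]])
  qed
qed

lemma higher_differentiable_on_Suc_lower:
  "higher_differentiable_on (Suc n) S f \<Longrightarrow> higher_differentiable_on n S f"
proof (induction n arbitrary: f)
  case 0
  then show ?case
    by (auto intro!: differentiable_imp_continuous_on simp: differentiable_on_def
        differentiable_at_withinI)
next
  case (Suc n)
  then show ?case
    by (metis higher_differentiable_on.simps(2))
qed

lemma higher_differentiable_on_const:
  assumes "open S"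
  shows "higher_differentiable_on n S (\<lambda>x. c)"
proof (induction n arbitrary: c)
  case (Suc n)
  show ?case
    by (rule higher_differentiable_on_SucI[OF assms has_derivative_const Suc])
qed simp

lemma higher_differentiable_on_add:
  assumes "open S" "higher_differentiable_on n S f" "higher_differentiable_on n S g"
  shows "higher_differentiable_on n S (\<lambda>x. f x + g x)"
  using assms(2,3)
proof (induction n arbitrary: f g)
  case 0
  then show ?case
    by (auto intro!: continuous_intros)
next
  case (Suc n)
  show ?case
  proof (rule higher_differentiable_on_SucI[OF assms(1) has_derivative_add[
          OF higher_differentiable_on_has_derivative[OF Suc.prems(1)]
            higher_differentiable_on_has_derivative[OF Suc.prems(2)]]])
    show "higher_differentiable_on n S
        (\<lambda>x. frechet_derivative f (at x) v + frechet_derivative g (at x) v)" for v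
      using Suc by simp
  qed
qed

lemma higher_differentiable_on_sum:
  assumes "open S" "\<And>i. i \<in> I \<Longrightarrow> higher_differentiable_on n S (f i)"
  shows "higher_differentiable_on n S (\<lambda>x. \<Sum>i\<in>I. f i x)"
  using assms(2)
proof (induction I rule: infinite_finite_induct)
  case (insert i I)
  have "higher_differentiable_on n S (\<lambda>x. f i x + (\<Sum>j\<in>I. f j x))"
    by (rule higher_differentiable_on_add[OF assms(1)]) (use insert in blast)+
  then show ?case
    by (simp only: sum.insert[OF insert.hyps])
qed (simp_all only: sum.infinite sum.empty higher_differentiable_on_const[OF assms(1)] not_False_eq_True)

lemma higher_differentiable_on_bounded_linear:
  assumes L: "bounded_linear L" and "open S" "higher_differentiable_on n S f"
  shows "higher_differentiable_on n S (\<lambda>x. L (f x))"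
  using assms(3)
proof (induction n arbitrary: f)
  case 0
  then show ?case
    by (auto intro!: bounded_linear.continuous_on[OF L])
next
  case (Suc n)
  show ?case
  proof (rule higher_differentiable_on_SucI[OF assms(2) bounded_linear.has_derivative[
          OF L higher_differentiable_on_has_derivative[OF Suc.prems]]])
    show "higher_differentiable_on n S (\<lambda>x. L (frechet_derivative f (at x) v))" for v
      using Suc by simp
  qed
qed

lemma higher_differentiable_on_bounded_bilinear:
  assumes B: "bounded_bilinear B" and "open S"
    and "higher_differentiable_on n S f" "higher_differentiable_on n S g"
  shows "higher_differentiable_on n S (\<lambda>x. B (f x) (g x))"
  using assms(3,4)
proof (induction n arbitrary: f g)
  case 0
  then show ?case
    by (auto intro!: bounded_bilinear.continuous_on[OF B])
next
  case (Suc n)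
  have low: "higher_differentiable_on n S f" "higher_differentiable_on n S g"
    using Suc.prems higher_differentiable_on_Suc_lower by blast+
  show ?case
  proof (rule higher_differentiable_on_SucI[OF assms(2) bounded_bilinear.FDERIV[
          OF B higher_differentiable_on_has_derivative[OF Suc.prems(1)]
            higher_differentiable_on_has_derivative[OF Suc.prems(2)]]])
    show "higher_differentiable_on n S
        (\<lambda>x. B (f x) (frechet_derivative g (at x) v) + B (frechet_derivative f (at x) v) (g x))"
      for v
      using Suc low by (intro higher_differentiable_on_add assms(2)) auto
  qed
qed

lemmas higher_differentiable_on_mult =
  higher_differentiable_on_bounded_bilinear[OF bounded_bilinear_mult]

text \<open>
  Expanding the increment of the inner function in an orthonormal basis turns the chain rule into
  a finite sum of products, whose factors are of class \<open>C\<^sup>n\<close> by the induction hypothesis.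
\<close>

lemma higher_differentiable_on_compose:
  fixes f :: "'a::euclidean_space \<Rightarrow> 'b::euclidean_space" and g :: "'b \<Rightarrow> 'c::real_normed_vector"
  assumes "open S" "open T" "f ` S \<subseteq> T"
    and "higher_differentiable_on n S f" "higher_differentiable_on n T g"
  shows "higher_differentiable_on n S (\<lambda>x. g (f x))"
  using assms(4,5)
proof (induction n arbitrary: g)
  case 0
  then show ?case
    using assms(3) by (auto intro: continuous_on_compose2)
next
  case (Suc n)
  note f' = higher_differentiable_on_has_derivative[OF Suc.prems(1)]
  note g' = higher_differentiable_on_has_derivative[OF Suc.prems(2)]
  have lin: "linear (frechet_derivative g (at (f x)))" if "x \<in> S" for x
    using has_derivative_linear[OF g'[of "f x"]] assms(3) that by auto
  have expand: "frechet_derivative g (at (f x)) u =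
      (\<Sum>b\<in>Basis. (u \<bullet> b) *\<^sub>R frechet_derivative g (at (f x)) b)" if "x \<in> S" for x u
  proof -
    have "frechet_derivative g (at (f x)) u
        = frechet_derivative g (at (f x)) (\<Sum>b\<in>Basis. (u \<bullet> b) *\<^sub>R b)"
      by (simp add: euclidean_representation)
    also have "\<dots> = (\<Sum>b\<in>Basis. (u \<bullet> b) *\<^sub>R frechet_derivative g (at (f x)) b)"
      by (simp only: linear_sum[OF lin[OF that]] linear_scale[OF lin[OF that]])
    finally show ?thesis .
  qed
  show ?case
  proof (rule higher_differentiable_on_SucI[OF assms(1)])
    fix x assume x: "x \<in> S"
    have "((\<lambda>x. g (f x)) has_derivative
        (\<lambda>v. frechet_derivative g (at (f x)) (frechet_derivative f (at x) v))) (at x)"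
      using diff_chain_at[OF f' g', of x] x assms(3) by (auto simp: o_def)
    then show "((\<lambda>x. g (f x)) has_derivative (\<lambda>v. \<Sum>b\<in>Basis.
        (frechet_derivative f (at x) v \<bullet> b) *\<^sub>R frechet_derivative g (at (f x)) b)) (at x)"
      by (simp only: expand[OF x, of "frechet_derivative f (at x) v" for v])
  next
    fix v
    have "higher_differentiable_on n S (\<lambda>x. frechet_derivative f (at x) v \<bullet> b)" for b
      by (rule higher_differentiable_on_bounded_linear[OF bounded_linear_inner_left assms(1)])
        (use Suc.prems(1) in simp)
    moreover have "higher_differentiable_on n S (\<lambda>x. frechet_derivative g (at (f x)) b)" for b
      by (rule Suc.IH[OF higher_differentiable_on_Suc_lower[OF Suc.prems(1)]])
        (use Suc.prems(2) in simp)
    ultimately show "higher_differentiable_on n S (\<lambda>x. \<Sum>b\<in>Basis.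
        (frechet_derivative f (at x) v \<bullet> b) *\<^sub>R frechet_derivative g (at (f x)) b)"
      by (intro higher_differentiable_on_sum assms(1)
          higher_differentiable_on_bounded_bilinear[OF bounded_bilinear_scaleR])
  qed
qed

lemma higher_differentiable_on_Pair:
  assumes "open S" "higher_differentiable_on n S f" "higher_differentiable_on n S g"
  shows "higher_differentiable_on n S (\<lambda>x. (f x, g x))"
  using assms(2,3)
proof (induction n arbitrary: f g)
  case 0
  then show ?case
    by (auto intro!: continuous_intros)
next
  case (Suc n)
  show ?case
  proof (rule higher_differentiable_on_SucI[OF assms(1) has_derivative_Pair[
          OF higher_differentiable_on_has_derivative[OF Suc.prems(1)]
            higher_differentiable_on_has_derivative[OF Suc.prems(2)]]])
    show "higher_differentiable_on n S
        (\<lambda>x. (frechet_derivative f (at x) v, frechet_derivative g (at x) v))" for v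
      using Suc by simp
  qed
qed

lemma higher_differentiable_on_ident:
  "higher_differentiable_on n (UNIV :: real set) (\<lambda>x. x)"
proof (cases n)
  case (Suc m)
  then show ?thesis
    using higher_differentiable_on_Suc_real[of UNIV "\<lambda>x::real. x" "\<lambda>_. 1" m]
      higher_differentiable_on_const[of UNIV m "1::real"] by auto
qed simp

lemma has_vector_derivative_cis: "(cis has_vector_derivative \<i> * cis t) (at t)"
  unfolding has_vector_derivative_def
  by (auto intro!: derivative_eq_intros simp: scaleR_conv_of_real mult.commute)

lemma higher_differentiable_on_cis: "higher_differentiable_on n UNIV cis"
proof (induction n)
  case 0
  show ?case
    by (auto intro!: continuous_intros)
next
  case (Suc n)
  have "higher_differentiable_on n UNIV (\<lambda>t. \<i> * cis t)"
    by (rule higher_differentiable_on_bounded_linear[OF bounded_linear_mult_right open_UNIV Suc])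
  then show ?case
    by (simp only: higher_differentiable_on_Suc_real[OF open_UNIV has_vector_derivative_cis])
qed

lemma higher_differentiable_on_inverse:
  "higher_differentiable_on n {0<..} (inverse :: real \<Rightarrow> real)"
proof (induction n)
  case 0
  show ?case
    by (auto intro!: continuous_intros)
next
  case (Suc n)
  have "(inverse has_vector_derivative - 1 * (inverse x * inverse x)) (at x)"
    if "x \<in> {0<..}" for x :: real
    using that DERIV_inverse[of x]
    by (simp add: has_real_derivative_iff_has_vector_derivative power2_eq_square)
  moreover have "higher_differentiable_on n {0<..} (\<lambda>x::real. - 1 * (inverse x * inverse x))"
    by (intro higher_differentiable_on_mult higher_differentiable_on_const Suc) auto
  ultimately show ?case
    using higher_differentiable_on_Suc_real[of "{0<..}" inverse
        "\<lambda>x::real. - 1 * (inverse x * inverse x)"]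
    by (meson open_greaterThan)
qed

lemma higher_differentiable_on_sqrt: "higher_differentiable_on n {0<..} sqrt"
proof (induction n)
  case 0
  show ?case
    by (auto intro!: continuous_intros)
next
  case (Suc n)
  have "(sqrt has_vector_derivative inverse (sqrt x) * (1 / 2)) (at x)" if "x \<in> {0<..}" for x
    using that DERIV_real_sqrt[of x]
    by (simp add: has_real_derivative_iff_has_vector_derivative field_simps)
  moreover have "higher_differentiable_on n {0<..} (\<lambda>x. inverse (sqrt x) * (1 / 2))"
    by (intro higher_differentiable_on_mult higher_differentiable_on_const
        higher_differentiable_on_compose[OF _ _ _ Suc higher_differentiable_on_inverse]) auto
  ultimately show ?case
    using higher_differentiable_on_Suc_real[of "{0<..}" sqrt "\<lambda>x. inverse (sqrt x) * (1 / 2)"]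
    by (meson open_greaterThan)
qed

text \<open>
  The equation \<open>H' = 1 / (M' \<circ> H)\<close> gains one order of regularity of \<open>H\<close> at a time.
\<close>

lemma higher_differentiable_on_inverse_function:
  fixes H M m :: "real \<Rightarrow> real"
  assumes "\<And>t. (M has_real_derivative m t) (at t)" and pos: "\<And>t. m t > 0"
    and m: "higher_differentiable_on n UNIV m"
    and HM: "\<And>t. H (M t) = t" and MH: "\<And>t. M (H t) = t"
  shows "higher_differentiable_on (Suc n) UNIV H"
proof -
  have contM: "isCont M t" for t
    by (rule DERIV_isCont[OF assms(1)])
  have contH: "isCont H t" for t
    using isCont_inverse_function[of 1 "H t" H M] HM contM by (simp add: MH)
  have H': "(H has_vector_derivative inverse (m (H t))) (at t)" for t
    using DERIV_inverse_function[of M "m (H t)" H t "t - 1" "t + 1"] assms(1) pos[of "H t"] MH contH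
    by (simp add: has_real_derivative_iff_has_vector_derivative[symmetric])
  have m_le: "higher_differentiable_on j UNIV m" if "j \<le> n" for j
    using that by (induction rule: inc_induct) (rule m, rule higher_differentiable_on_Suc_lower)
  have H_Cn: "higher_differentiable_on j UNIV H" if "j \<le> Suc n" for j
    using that
  proof (induction j)
    case 0
    show ?case
      using contH by (simp add: continuous_on_eq_continuous_at)
  next
    case (Suc j)
    have "higher_differentiable_on j UNIV (\<lambda>t. m (H t))"
      by (rule higher_differentiable_on_compose[of UNIV UNIV]) (use Suc m_le in auto)
    then have "higher_differentiable_on j UNIV (\<lambda>t. inverse (m (H t)))"
      by (rule higher_differentiable_on_compose[OF _ _ _ _ higher_differentiable_on_inverse, rotated 3])
        (auto simp: pos)
    then show ?case
      using higher_differentiable_on_Suc_real[of UNIV H, OF _ H'] by simp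
  qed
  show ?thesis
    by (rule H_Cn[OF order_refl])
qed

section \<open>Circle maps and their lifts\<close>

lemma cis_eq_iff: "cis s = cis t \<longleftrightarrow> (\<exists>n::int. s = t + 2 * pi * n)"
  by (metis cis.sel sin_cos_eq_iff cis.ctr)

lemma cis_Arg_circle: "z \<in> circle \<Longrightarrow> cis (Arg z) = z"
  by (cases "z = 0") (simp_all add: cis_Arg sgn_div_norm)

lemma cis_in_circle: "cis t \<in> circle"
  by simp

lemma degree_one_shift:
  fixes F :: "real \<Rightarrow> real"
  assumes "\<And>t. F (t + 2 * pi) = F t + 2 * pi"
  shows "F (t + 2 * pi * of_int n) = F t + 2 * pi * of_int n"
proof (induction n rule: int_induct[of _ 0])
  case (step1 i)
  then show ?case
    using assms[of "t + 2 * pi * of_int i"] by (simp add: algebra_simps)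
next
  case (step2 i)
  then show ?case
    using assms[of "t + 2 * pi * of_int (i - 1)"] by (simp add: algebra_simps)
qed simp

text \<open>
  A map of the line that commutes with a full turn descends to the circle; with \<open>Arg\<close> choosing a
  preimage, the descended map is \<open>\<lambda>z. cis (F (Arg z))\<close>.
\<close>

lemma circle_map_of_lift:
  fixes F :: "real \<Rightarrow> real"
  assumes "\<And>t. F (t + 2 * pi) = F t + 2 * pi"
  shows "cis (F (Arg (cis t))) = cis (F t)"
proof -
  have "cis (Arg (cis t)) = cis t"
    by (simp add: cis_Arg_circle)
  then obtain n :: int where "Arg (cis t) = t + 2 * pi * n"
    using cis_eq_iff by blast
  then show ?thesis
    using degree_one_shift[of F, OF assms, of t n] by (metis cis_eq_iff)
qed

text \<open>
  A path of class \<open>C\<^sup>1\<close> in the circle has its velocity orthogonal to its position, so the angular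
  velocity is \<open>Im (f' * cnj f)\<close> and the angle is obtained by integration.
\<close>

lemma circle_path_lift:
  fixes f :: "real \<Rightarrow> complex"
  assumes unit: "\<And>t. f t \<in> circle" and "Ck_on \<infinity> UNIV f"
  obtains F F' :: "real \<Rightarrow> real"
  where "\<And>t. f t = cis (F t)" "\<And>t. (F has_real_derivative F' t) (at t)"
    "\<And>n. higher_differentiable_on n UNIV F'"
proof -
  have f: "higher_differentiable_on n UNIV f" for n
    using assms(2) by (auto simp: Ck_on_def)
  define f' where "f' t = vector_derivative f (at t)" for t
  have f': "(f has_vector_derivative f' t) (at t)" for t
    using f[of 1] unfolding f'_def by (simp add: vector_derivative_works)
  have f'_Cn: "higher_differentiable_on n UNIV f'" for n
    using higher_differentiable_on_Suc_real[of UNIV f, OF _ f'] f by blast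
  have norm1: "f t * cnj (f t) = 1" for t
    using unit[of t] by (simp flip: complex_norm_square)
  define F' where "F' t = Im (f' t * cnj (f t))" for t
  have F'_Cn: "higher_differentiable_on n UNIV F'" for n
    unfolding F'_def
    by (intro higher_differentiable_on_bounded_linear[OF bounded_linear_Im]
        higher_differentiable_on_mult f'_Cn f
        higher_differentiable_on_bounded_linear[OF bounded_linear_cnj]) auto
  have vel: "f' t = \<i> * F' t * f t" for t
  proof -
    have "((\<lambda>t. f t * cnj (f t)) has_vector_derivative f t * cnj (f' t) + f' t * cnj (f t)) (at t)"
      by (intro derivative_intros has_vector_derivative_cnj f')
    moreover have "((\<lambda>t. f t * cnj (f t)) has_vector_derivative 0) (at t)"
      by (simp add: norm1)
    ultimately have "f t * cnj (f' t) + f' t * cnj (f t) = 0"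
      by (rule vector_derivative_unique_at)
    then have "Re (f' t * cnj (f t)) = 0"
      by (auto simp: complex_eq_iff algebra_simps)
    then have "f' t * cnj (f t) = \<i> * F' t"
      by (auto simp: complex_eq_iff F'_def)
    then have "f' t * (f t * cnj (f t)) = \<i> * F' t * f t"
      by (simp add: algebra_simps)
    then show ?thesis
      by (simp add: norm1)
  qed
  have "isCont F' t" for t
    using F'_Cn[of 0] by (simp add: continuous_on_eq_continuous_at)
  then obtain G where G: "\<And>t. (G has_real_derivative F' t) (at t)"
    using einterval_antiderivative[of "-\<infinity>" "\<infinity>" F']
    by (auto simp: has_real_derivative_iff_has_vector_derivative)
  \<comment> \<open>The constant is chosen so that \<open>f\<close> and \<open>cis \<circ> F\<close> agree at zero; their quotient is constant.\<close>
  define F where "F t = G t - G 0 + Arg (f 0)" for t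
  have F: "(F has_real_derivative F' t) (at t)" for t
    unfolding F_def using G by (auto intro!: derivative_eq_intros)
  have "((\<lambda>t. f t * cis (- F t)) has_vector_derivative 0) (at t)" for t
  proof -
    have "((\<lambda>t. cis (- F t)) has_vector_derivative - F' t *\<^sub>R (\<i> * cis (- F t))) (at t)"
      using F[of t] unfolding has_field_derivative_def has_vector_derivative_def
      by (auto intro!: derivative_eq_intros simp: fun_eq_iff scaleR_conv_of_real)
    from has_vector_derivative_mult[OF f'[of t] this] show ?thesis
      by (simp add: vel scaleR_conv_of_real algebra_simps)
  qed
  then obtain c where c: "\<And>t. f t * cis (- F t) = c"
    using has_vector_derivative_zero_constant[of UNIV "\<lambda>t. f t * cis (- F t)"] by auto
  have "c = 1"
    using c[of 0] cis_Arg_circle[OF unit[of 0]] norm1[of 0]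
    by (metis F_def add_0 cis_cnj diff_self)
  then have f_eq: "f t = cis (F t)" for t
    using c[of t] by (simp add: cis_mult flip: cis_inverse) (simp add: divide_simps)
  show thesis
    by (rule that[OF f_eq F F'_Cn])
qed

text \<open>
  The differentiable inverse forces the derivative of the lift to vanish nowhere. If it were
  negative then, over one turn, \<open>F t - t\<close> would drop by at least \<open>4 * pi\<close>, and so meet a multiple of
  \<open>2 * pi\<close>, which is a fixed point.
\<close>

lemma fixed_point_free_lift:
  assumes diffeo: "circle_diffeo \<infinity> \<phi>" and free: "\<forall>x\<in>circle. \<phi> x \<noteq> x"
  obtains F F' :: "real \<Rightarrow> real"
  where "\<And>t. \<phi> (cis t) = cis (F t)" "\<And>t. (F has_real_derivative F' t) (at t)"
    "\<And>n. higher_differentiable_on n UNIV F'" "\<And>t. F' t > 0"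
proof -
  have bij: "bij_betw \<phi> circle circle" and \<phi>: "Ck_on \<infinity> UNIV (\<lambda>t. \<phi> (cis t))"
    and \<psi>: "Ck_on \<infinity> UNIV (\<lambda>t. inv_into circle \<phi> (cis t))"
    using diffeo by (auto simp: circle_diffeo_def)
  have "\<phi> (cis t) \<in> circle" for t
    using bij bij_betwE cis_in_circle by blast
  then obtain F F' where lift: "\<And>t. \<phi> (cis t) = cis (F t)"
    and F: "\<And>t. (F has_real_derivative F' t) (at t)"
    and F': "\<And>n. higher_differentiable_on n UNIV F'"
    using circle_path_lift[OF _ \<phi>] by blast
  have nz: "F' t \<noteq> 0" for t
  proof
    assume "F' t = 0"
    define g where "g t = inv_into circle \<phi> (cis t)" for t
    have "higher_differentiable_on 1 UNIV g"
      using \<psi> by (simp only: Ck_on_def g_def[abs_def] enat_ord_simps simp_thms)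
    then have "(g has_vector_derivative vector_derivative g (at (F t))) (at (F t))"
      by (simp add: vector_derivative_works)
    then have "(g \<circ> F has_vector_derivative F' t *\<^sub>R vector_derivative g (at (F t))) (at t)"
      using F[of t] vector_diff_chain_at[of F "F' t" t g]
      by (simp add: has_real_derivative_iff_has_vector_derivative)
    moreover have "g \<circ> F = cis"
      using bij_betw_inv_into_left[OF bij cis_in_circle] by (auto simp: g_def lift[symmetric])
    ultimately have "\<i> * cis t = F' t *\<^sub>R vector_derivative g (at (F t))"
      using vector_derivative_unique_at[OF has_vector_derivative_cis] by metis
    then show False
      using \<open>F' t = 0\<close> by simp
  qed
  have contF': "continuous_on A F'" for A
    using F'[of 0] continuous_on_subset by fastforce
  have contF: "continuous_on A F" for A
    by (rule DERIV_continuous_on[OF has_field_derivative_at_within[OF F]])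
  have F'_pos: "F' t > 0" for t
  proof (rule ccontr)
    assume "\<not> F' t > 0"
    have neg: "F' s < 0" for s
    proof (rule ccontr)
      assume "\<not> F' s < 0"
      then have "0 \<in> F' ` UNIV"
        using connected_contains_Icc[of "F' ` UNIV" "F' t" "F' s"] \<open>\<not> F' t > 0\<close>
          connected_continuous_image[OF contF' connected_UNIV] by auto
      then show False
        using nz by force
    qed
    have lt: "F (2 * pi) < F 0"
      by (rule DERIV_neg_imp_decreasing[of 0 "2 * pi" F]) (use F neg in auto)
    have "cis (F 0) = cis (F (2 * pi))"
      using lift[of 0] lift[of "2 * pi"] by simp
    then obtain d :: int where d: "F 0 = F (2 * pi) + 2 * pi * d"
      using cis_eq_iff by blast
    have "0 < 2 * pi * d"
      using lt d by linarith
    then have "d \<ge> 1"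
      by (simp add: zero_less_mult_iff)
    then have "2 * pi * d \<ge> 2 * pi * 1"
      by (intro mult_left_mono) auto
    then have drop: "F (2 * pi) - 2 * pi \<le> F 0 - 4 * pi"
      using d by linarith
    \<comment> \<open>\<open>2 * pi * N\<close> is the largest multiple of \<open>2 * pi\<close> not exceeding \<open>F t - t\<close> at zero.\<close>
    define N :: int where "N = \<lfloor>F 0 / (2 * pi)\<rfloor>"
    have "N \<le> F 0 / (2 * pi)" "F 0 / (2 * pi) < N + 1"
      unfolding N_def by linarith+
    then have "2 * pi * N \<le> F 0" "F 0 < 2 * pi * N + 2 * pi"
      by (simp_all add: field_simps)
    then have "\<exists>x\<ge>0. x \<le> 2 * pi \<and> F x - x = 2 * pi * N"
      using drop by (intro IVT2' continuous_intros contF) auto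
    then obtain x where "F x = x + 2 * pi * N"
      by (auto simp: algebra_simps)
    then have "\<phi> (cis x) = cis x"
      using lift cis_eq_iff by metis
    then show False
      using free cis_in_circle by blast
  qed
  show thesis
    by (rule that[OF lift F F' F'_pos])
qed

section \<open>Straightening an invariant density\<close>

text \<open>
  A positive periodic density becomes the constant density in the coordinate given by its
  normalised integral, so that a map preserving it becomes a translation of that coordinate.
\<close>

lemma conjugate_to_rotation_of_invariant_density:
  fixes F F' m :: "real \<Rightarrow> real"
  assumes lift: "\<And>t. \<phi> (cis t) = cis (F t)"
    and F: "\<And>t. (F has_real_derivative F' t) (at t)"
    and pos: "\<And>t. m t > 0" and per: "\<And>t. m (t + 2 * pi) = m t"
    and inv: "\<And>t. m (F t) * F' t = m t" and m: "Ck_on k UNIV m"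
  shows "\<exists>h. circle_diffeo (k + 1) h \<and> is_rotation (inv_into circle h \<circ> \<phi> \<circ> h)"
proof -
  have m_Cn: "higher_differentiable_on n UNIV m" if "enat n \<le> k" for n
    using m that by (auto simp: Ck_on_def)
  have "isCont m t" for t
    using m_Cn[of 0] by (simp add: continuous_on_eq_continuous_at flip: zero_enat_def)
  then obtain A where A: "\<And>t. (A has_real_derivative m t) (at t)"
    using einterval_antiderivative[of "-\<infinity>" "\<infinity>" m]
    by (auto simp: has_real_derivative_iff_has_vector_derivative)
  define T where "T = A (2 * pi) - A 0"
  have "T > 0"
    unfolding T_def using DERIV_pos_imp_increasing[of 0 "2 * pi" A] A pos by auto
  define c where "c = 2 * pi / T"
  have "c > 0"
    using \<open>T > 0\<close> by (simp add: c_def)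
  define M where "M t = c * A t" for t
  have M: "(M has_real_derivative c * m t) (at t)" for t
    unfolding M_def using A by (auto intro!: derivative_eq_intros)
  have pos': "c * m t > 0" for t
    using pos \<open>c > 0\<close> by simp
  have M_per: "M (t + 2 * pi) = M t + 2 * pi" for t
  proof -
    have "((\<lambda>t. M (t + 2 * pi) - M t) has_real_derivative c * m (t + 2 * pi) - c * m t) (at t)" for t
      by (intro derivative_intros M DERIV_shift[THEN iffD1])
    then have "M (t + 2 * pi) - M t = M (0 + 2 * pi) - M 0"
      by (intro DERIV_isconst_all allI) (simp add: per)
    also have "\<dots> = 2 * pi"
      using \<open>T > 0\<close> by (simp add: M_def flip: right_diff_distrib T_def) (simp add: c_def)
    finally show ?thesis
      by simp
  qed
  have mono: "strict_mono M"
    by (rule strict_monoI) (use M pos' in \<open>blast intro: DERIV_pos_imp_increasing\<close>)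
  have contM: "continuous_on UNIV M"
    by (rule DERIV_continuous_on[OF has_field_derivative_at_within[OF M]])
  have "surj M"
  proof -
    have "y \<in> range M" for y
    proof -
      \<comment> \<open>Enough full turns in both directions for \<open>M\<close> to pass \<open>y\<close>.\<close>
      define N :: int where "N = \<lceil>\<bar>y - M 0\<bar> / (2 * pi)\<rceil>"
      have "\<bar>y - M 0\<bar> / (2 * pi) \<le> N"
        unfolding N_def by linarith
      then have "\<bar>y - M 0\<bar> \<le> 2 * pi * N"
        by (simp add: field_simps)
      then have "M (0 + 2 * pi * of_int (- N)) \<le> y" "y \<le> M (0 + 2 * pi * of_int N)"
        unfolding degree_one_shift[of M, OF M_per] by (auto simp: abs_le_iff)
      then show ?thesis
        using connected_contains_Icc[OF connected_continuous_image[OF contM connected_UNIV]]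
        by (meson atLeastAtMost_iff rangeI subsetD)
    qed
    then show ?thesis
      by blast
  qed
  define H where "H = inv M"
  have HM: "H (M t) = t" for t
    unfolding H_def by (simp add: strict_mono_imp_inj_on[OF mono])
  have MH: "M (H t) = t" for t
    unfolding H_def by (rule surj_f_inv_f[OF \<open>surj M\<close>])
  have H_per: "H (t + 2 * pi) = H t + 2 * pi" for t
    by (metis HM MH M_per)
  have "((\<lambda>t. M (F t) - M t) has_real_derivative c * m (F t) * F' t - c * m t) (at t)" for t
    by (intro derivative_intros M DERIV_chain2[OF M F])
  moreover have "c * m (F t) * F' t - c * m t = 0" for t
    using inv[of t] by (simp add: mult.assoc)
  ultimately obtain a where a: "\<And>t. M (F t) = M t + a"
    using DERIV_isconst_all[of "\<lambda>t. M (F t) - M t"]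
    by (metis add.commute diff_add_cancel)

  define h where "h z = cis (H (Arg z))" for z
  define g where "g z = cis (M (Arg z))" for z
  have h: "h (cis t) = cis (H t)" and g: "g (cis t) = cis (M t)" for t
    unfolding h_def g_def using circle_map_of_lift H_per M_per by blast+
  have circ: "\<exists>t. z = cis t" if "z \<in> circle" for z
    using cis_Arg_circle[OF that] by metis
  have gh: "g (h z) = z" and hg: "h (g z) = z" if "z \<in> circle" for z
    using circ[OF that] by (auto simp: g h HM MH)
  have bij: "bij_betw h circle circle"
    by (rule bij_betw_byWitness[where f' = g]) (use gh hg in \<open>auto simp: h_def g_def\<close>)
  have inv_h: "inv_into circle h z = g z" if "z \<in> circle" for z
    by (rule inv_into_f_eq) (use bij hg that in \<open>auto simp: bij_betw_def g_def\<close>)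
  have Cn: "higher_differentiable_on n UNIV H \<and> higher_differentiable_on n UNIV M"
    if n: "enat n \<le> k + 1" for n
  proof -
    have "higher_differentiable_on (Suc j) UNIV H \<and> higher_differentiable_on (Suc j) UNIV M"
      if j: "enat j \<le> k" for j
    proof -
      have "higher_differentiable_on j UNIV (\<lambda>t. c * m t)"
        by (intro higher_differentiable_on_bounded_linear[OF bounded_linear_mult_right] m_Cn j) simp
      then show ?thesis
        using higher_differentiable_on_inverse_function[OF M pos' _ HM MH]
          higher_differentiable_on_Suc_real[of UNIV M "\<lambda>t. c * m t" j] M
        by (auto simp: has_real_derivative_iff_has_vector_derivative)
    qed
    note step = this
    show ?thesis
    proof (cases n)
      case 0
      then show ?thesis
        using step[of 0] higher_differentiable_on_Suc_lower
        by (metis zero_enat_def zero_le)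
    next
      case (Suc j)
      then have "enat j \<le> k"
        using n by (cases k) (auto simp: one_enat_def)
      then show ?thesis
        using step Suc by blast
    qed
  qed
  have "circle_diffeo (k + 1) h"
    unfolding circle_diffeo_def
  proof (intro conjI bij)
    show "Ck_on (k + 1) UNIV (\<lambda>t. h (cis t))"
      unfolding Ck_on_def h using Cn
      by (auto intro!: higher_differentiable_on_compose[OF _ _ _ _ higher_differentiable_on_cis])
    show "Ck_on (k + 1) UNIV (\<lambda>t. inv_into circle h (cis t))"
      unfolding Ck_on_def inv_h[OF cis_in_circle] g using Cn
      by (auto intro!: higher_differentiable_on_compose[OF _ _ _ _ higher_differentiable_on_cis])
  qed
  moreover have "(inv_into circle h \<circ> \<phi> \<circ> h) x = cis a * x" if "x \<in> circle" for x
    using circ[OF that]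
    by (auto simp: h lift inv_h g a MH cis_mult add.commute)
  ultimately show ?thesis
    unfolding is_rotation_def by blast
qed

theorem proposition1p6:
  fixes k :: enat and \<phi> :: "complex \<Rightarrow> complex"
  assumes "circle_diffeo \<infinity> \<phi>"
    and "\<forall>x\<in>circle. \<phi> x \<noteq> x"
    and "\<exists>\<omega>. volume_form k \<omega> \<and> preserves_form \<phi> \<omega>"
  shows "\<exists>h. circle_diffeo (k + 1) h \<and> is_rotation (inv_into circle h \<circ> \<phi> \<circ> h)"
proof -
  obtain F F' where lift: "\<And>t. \<phi> (cis t) = cis (F t)"
    and F: "\<And>t. (F has_real_derivative F' t) (at t)"
    and F'_Cn: "\<And>n. higher_differentiable_on n UNIV F'" and F'_pos: "\<And>t. F' t > 0"
    using fixed_point_free_lift[OF assms(1,2)] by blast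
  obtain \<omega> where vol: "volume_form k \<omega>" and pres: "preserves_form \<phi> \<omega>"
    using assms(3) by blast
  have circle_deriv: "circle_deriv \<phi> (cis t) = F' t" for t
    by (rule circle_deriv_lift[OF lift F])
  have graph: "(cis t, cis (F t)) \<in> config_space" for t
    using assms(2) cis_in_circle[of t] lift[of t] by (auto simp: config_space_def)
  define p where "p t = \<omega> (cis t, cis (F t))" for t
  have p_pos: "p t > 0" for t
    using vol graph by (auto simp: p_def volume_form_def)
  have p_inv: "p (F t) * F' t * F' (F t) = p t" for t
    using pres[unfolded preserves_form_def, rule_format, OF graph[of t]]
    by (simp add: p_def circle_deriv flip: lift) (simp add: lift circle_deriv)
  define m where "m t = sqrt (p t * F' t)" for t
  show ?thesis
  proof (rule conjugate_to_rotation_of_invariant_density[OF lift F])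
    show "m t > 0" for t
      using p_pos F'_pos by (simp add: m_def)
    have "cis (t + 2 * pi) = cis t" for t
      by (simp flip: cis_mult)
    then show "m (t + 2 * pi) = m t" for t
      unfolding m_def p_def by (metis circle_deriv lift)
    show "m (F t) * F' t = m t" for t
    proof -
      have "m (F t) * F' t = sqrt (p (F t) * F' (F t) * (F' t)\<^sup>2)"
        using F'_pos[of t] by (simp add: m_def real_sqrt_mult)
      also have "p (F t) * F' (F t) * (F' t)\<^sup>2 = p t * F' t"
        by (simp add: p_inv[of t, symmetric] power2_eq_square)
      finally show ?thesis
        by (simp add: m_def)
    qed
    let ?U = "{(s::real, t::real). (cis s, cis t) \<in> config_space}"
    have "?U = {p. cis (fst p) \<noteq> cis (snd p)}"
      by (auto simp: config_space_def)
    moreover have "open {p :: real \<times> real. cis (fst p) \<noteq> cis (snd p)}"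
      by (intro open_Collect_neq continuous_intros)
    ultimately have "open ?U"
      by simp
    show "Ck_on k UNIV m"
      unfolding Ck_on_def
    proof (intro allI impI)
      fix n assume n: "enat n \<le> k"
      have w: "higher_differentiable_on n ?U (\<lambda>(s, t). \<omega> (cis s, cis t))"
        using vol n by (auto simp: volume_form_def Ck_on_def)
      have "higher_differentiable_on (Suc n) UNIV F"
        using higher_differentiable_on_Suc_real[of UNIV F F' n] F F'_Cn
        by (auto simp: has_real_derivative_iff_has_vector_derivative)
      then have "higher_differentiable_on n UNIV (\<lambda>t. (t, F t))"
        by (intro higher_differentiable_on_Pair[OF open_UNIV higher_differentiable_on_ident]
            higher_differentiable_on_Suc_lower[of n UNIV F])
      from higher_differentiable_on_compose[OF open_UNIV \<open>open ?U\<close> _ this w]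
      have "higher_differentiable_on n UNIV p"
        using graph by (auto simp: p_def[abs_def])
      then have "higher_differentiable_on n UNIV (\<lambda>t. p t * F' t)"
        by (intro higher_differentiable_on_mult F'_Cn) auto
      then show "higher_differentiable_on n UNIV m"
        unfolding m_def[abs_def]
        by (rule higher_differentiable_on_compose[OF _ _ _ _ higher_differentiable_on_sqrt, rotated 3])
          (auto simp: p_pos F'_pos)
    qed
  qed
qed

end
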